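(* Let the RIS phase shifts be set as $\theta_n=-\angle h_{p,n}^\ast+\angle\sum_{k\in\mathcal{K}}w_k h_{r,k,n}^\ast$ for all $n=1,\dots,N$, where $w_k>0$ ($k\in\mathcal{K}$) are arbitrary weight factors. Then for every $k\in\mathcal{K}$ and every $m\in\mathcal{M}$, $$\mathbb{E}[\ell_k]=\frac{\pi N\beta_k\sqrt{p_k}\,w_k}{4\lambda\sqrt{\sum_{i=1}^{K}w_i^2}},\qquad \mathbb{E}[\ell_m]=0,$$ where the expectations are over the random channels $\mathbf{h}_p$ and $\mathbf{h}_{r,i}$, $i\in\mathcal{K}\cup\mathcal{M}$.
   Context: Let $K,N,M\ge 1$ be integers, $\mathcal{K}=\{1,\dots,K\}$ (target devices) and $\mathcal{M}=\{K+1,\dots,K+M\}$ (interferers). The random vectors $\mathbf{h}_p=(h_{p,1},\dots,h_{p,N})^T$ and $\mathbf{h}_{r,i}=(h_{r,i,1},\dots,h_{r,i,N})^T$, $i\in\mathcal{K}\cup\mathcal{M}$, are mutually independent, each distributed as $\mathcal{CN}(\mathbf{0},\mathbf{I}_N)$ (i.i.d. circularly symmetric complex Gaussian entries of mean $0$ and variance $\mathbb{E}|\cdot|^2=1$). The constants $\beta_i>0$ (large-scale fading coefficients), $p_i>0$ (transmit powers), and $\lambda>0$ (denoising factor) are deterministic. The reflecting matrix is $\mathbf{\Theta}=\mathrm{diag}\{e^{j\theta_1},\dots,e^{j\theta_N}\}$ with $j=\sqrt{-1}$ (phases are understood modulo $2\pi$). $\angle z$ is the argument of $z$, $z^\ast$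 the complex conjugate, $(\cdot)^H$ the conjugate transpose, $\Re$ the real part. For $i\in\mathcal{K}\cup\mathcal{M}$ define the aggregation/interference coefficients $$\ell_i=\frac{\beta_i\sqrt{p_i}}{\lambda}\,\Re\{\mathbf{h}_p^H\mathbf{\Theta}\mathbf{h}_{r,i}\}.$$ *)

theory Defs
  imports "HOL-Probability.Probability" "HOL-Library.Real_Mod"
begin

context prob_space
begin

text \<open>
  The distribution $CN(0,v)$, for $v > 0$: real and imaginary part are independent real
  Gaussians of mean $0$ and variance $v/2$ each, so that $E|Z|^2 = v$.
  The second parameter of \<^const>\<open>normal_density\<close> is the standard deviation.
\<close>

definition circular_gaussian :: "real \<Rightarrow> ('a \<Rightarrow> complex) \<Rightarrow> bool" where
  "circular_gaussian v Z \<longleftrightarrow>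
     indep_var borel (\<lambda>\<omega>. Re (Z \<omega>)) borel (\<lambda>\<omega>. Im (Z \<omega>)) \<and>
     distributed M lborel (\<lambda>\<omega>. Re (Z \<omega>)) (normal_density 0 (sqrt (v / 2))) \<and>
     distributed M lborel (\<lambda>\<omega>. Im (Z \<omega>)) (normal_density 0 (sqrt (v / 2)))"

text \<open>The distribution $CN(0, I_N)$, where $N$ is the cardinality of the index type.\<close>

definition standard_complex_gaussian_vector :: "('a \<Rightarrow> complex ^ 'n) \<Rightarrow> bool" where
  "standard_complex_gaussian_vector h \<longleftrightarrow>
     indep_vars (\<lambda>_. borel) (\<lambda>n \<omega>. h \<omega> $ n) UNIV \<and>
     (\<forall>n. circular_gaussian 1 (\<lambda>\<omega>. h \<omega> $ n))"

end

definition hermitian_product :: "complex ^ 'n \<Rightarrow> complex ^ 'n \<Rightarrow> complex" where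
  "hermitian_product x y = (\<Sum>n\<in>UNIV. cnj (x $ n) * y $ n)"

definition reflecting_matrix :: "real ^ 'n \<Rightarrow> complex ^ 'n ^ 'n" where
  "reflecting_matrix \<theta> = (\<chi> m n. if m = n then cis (\<theta> $ n) else 0)"

text \<open>
  The coefficient $\ell_i$ as a function of the large-scale fading coefficient \<open>b\<close>, the
  transmit power \<open>q\<close>, the denoising factor \<open>l\<close>, the phase shifts and the two channels.
\<close>

definition aggregation_coeff ::
    "real \<Rightarrow> real \<Rightarrow> real \<Rightarrow> real ^ 'n \<Rightarrow> complex ^ 'n \<Rightarrow> complex ^ 'n \<Rightarrow> real" where
  "aggregation_coeff b q l \<theta> x y =
     b * sqrt q / l * Re (hermitian_product x (reflecting_matrix \<theta> *v y))"

end

theory Submission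
  imports Defs
begin

text \<open>
  With the prescribed phases each summand of $\ell_i$ is a multiple of
  $|h_{p,n}|\,\Re(\overline{\mathrm{sgn}\,T}\,h_{r,i,n})$ with $T = \sum_k w_k h_{r,k,n}$, and the
  two factors are independent. The expectation of the second one is the derivative at $t = 0$ of
  $E|T + t h_{r,i,n}|$. Every rotation of a weighted sum of independent circular Gaussians has a
  normal real part, so averaging over the rotations gives
  $E|\sum_k v_k h_k| = \frac{\sqrt\pi}{2} (\sum_k v_k^2)^{1/2}$. Interferers enter $T$ with weight $0$.
\<close>

section \<open>Integral geometry of the plane: the modulus as an average of real parts\<close>

lemma cmod_eq_average_Re_rotations:
  "(\<integral>\<^sup>+\<phi>. ennreal \<bar>Re (cis \<phi> * z)\<bar> * indicator {0..pi} \<phi> \<partial>lborel) = ennreal (2 * cmod z)"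
proof -
  \<comment> \<open>With z = r e^{ia} the integrand is r |cos(\<phi> + a)|, and |cos| integrates to
    2 over any interval of length pi. For Re z \<ge> 0 the angle a lies in [-pi/2, pi/2], so on
    \<open>{0..pi}\<close> the cosine changes sign only at pi/2 - a. The other half-plane follows by
    passing to -z, which leaves the integrand unchanged.\<close>
  have *: "((\<lambda>\<phi>. \<bar>Re (cis \<phi> * z)\<bar>) has_integral 2 * cmod z) {0..pi}" if "Re z \<ge> 0" for z
  proof -
    \<comment> \<open>At z = 0 the quotient is 0 by convention, so a = 0 and the polar equations
      below still hold.\<close>
    define r a where "r = cmod z" and "a = arcsin (Im z / cmod z)"
    have "\<bar>Im z / cmod z\<bar> \<le> 1"
      by (simp add: abs_Im_le_cmod divide_le_eq_1)
    then have a: "-(pi/2) \<le> a" "a \<le> pi/2" and sin: "sin a = Im z / cmod z"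
      using arcsin[of "Im z / cmod z"] unfolding a_def abs_le_iff by auto
    have Im: "Im z = r * sin a"
      using sin by (cases "z = 0") (auto simp: r_def)
    have "0 \<le> cos a" using a by (intro cos_ge_zero) auto
    have "(Re z)\<^sup>2 = (r * cos a)\<^sup>2"
      using cmod_power2[of z] Im unfolding r_def[symmetric]
      by (simp add: power_mult_distrib cos_squared_eq algebra_simps)
    then have Re: "Re z = r * cos a"
      using \<open>Re z \<ge> 0\<close> \<open>0 \<le> cos a\<close> by (simp add: r_def)
    have eq: "\<bar>Re (cis \<phi> * z)\<bar> = r * \<bar>cos (\<phi> + a)\<bar>" for \<phi>
    proof -
      have "Re (cis \<phi> * z) = r * cos (\<phi> + a)"
        by (simp add: Re Im cos_add algebra_simps)
      then show ?thesis by (simp add: abs_mult r_def)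
    qed
    have deriv: "((\<lambda>\<phi>. sin (\<phi> + a)) has_vector_derivative cos (\<phi> + a)) (at \<phi> within S)" for \<phi> S
      unfolding has_real_derivative_iff_has_vector_derivative[symmetric]
      by (auto intro!: derivative_eq_intros)
    have "((\<lambda>\<phi>. cos (\<phi> + a)) has_integral (sin (pi/2 - a + a) - sin (0 + a))) {0..pi/2 - a}"
      using a by (intro fundamental_theorem_of_calculus deriv) auto
    then have 1: "((\<lambda>\<phi>. \<bar>cos (\<phi> + a)\<bar>) has_integral (1 - sin a)) {0..pi/2 - a}"
      using a by (subst has_integral_cong[where g = "\<lambda>\<phi>. cos (\<phi> + a)"]) 
         (auto intro!: abs_of_nonneg cos_ge_zero)
    have "((\<lambda>\<phi>. cos (\<phi> + a)) has_integral (sin (pi + a) - sin (pi/2 - a + a))) {pi/2 - a..pi}"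
      using a by (intro fundamental_theorem_of_calculus deriv) auto
    then have "((\<lambda>\<phi>. - cos (\<phi> + a)) has_integral - (sin (pi + a) - sin (pi/2 - a + a))) {pi/2 - a..pi}"
      by (rule has_integral_neg)
    moreover have "cos (\<phi> + a) \<le> 0" if "\<phi> \<in> {pi/2 - a..pi}" for \<phi>
    proof -
      have "0 \<le> cos (\<phi> + a - pi)"
        using that a by (intro cos_ge_zero) auto
      then show ?thesis by (simp add: cos_diff)
    qed
    ultimately have 2: "((\<lambda>\<phi>. \<bar>cos (\<phi> + a)\<bar>) has_integral (1 + sin a)) {pi/2 - a..pi}"
      by (subst has_integral_cong[where g = "\<lambda>\<phi>. - cos (\<phi> + a)"]) (auto simp: abs_of_nonpos add.commute)
    have "((\<lambda>\<phi>. \<bar>cos (\<phi> + a)\<bar>) has_integral (1 - sin a) + (1 + sin a)) {0..pi}"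
      by (rule has_integral_combine[OF _ _ 1 2]) (use a in auto)
    from has_integral_mult_right[OF this, of r] show ?thesis
      unfolding eq by (simp add: r_def mult.commute)
  qed
  have "((\<lambda>\<phi>. \<bar>Re (cis \<phi> * z)\<bar>) has_integral 2 * cmod z) {0..pi}"
    using *[of z] *[of "-z"] by (cases "Re z \<ge> 0") (auto simp: abs_minus_commute)
  then show ?thesis
    by (rule nn_integral_has_integral_lebesgue'[rotated]) simp
qed

text \<open>\<open>Arg\<close> jumps along the negative real axis, but \<open>cis\<close> undoes the
  jump, leaving \<open>sgn\<close> away from 0. At 0 the two differ: \<open>Arg 0 = 0\<close> gives
  the value 1, while \<open>sgn 0 = 0\<close>.\<close>

lemma borel_measurable_cis_Arg [measurable]: "(\<lambda>z. cis (Arg z)) \<in> borel_measurable borel"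
proof -
  have "(\<lambda>z. cis (Arg z)) = (\<lambda>z. if z = 0 then 1 else sgn z)"
    by (auto simp: cis_Arg Arg_zero)
  also have "\<dots> \<in> borel_measurable borel"
    by measurable
  finally show ?thesis .
qed

lemma borel_measurable_cnj [measurable]: "cnj \<in> borel_measurable borel"
  by (intro borel_measurable_continuous_onI continuous_intros)

section \<open>Expectations of weighted sums of independent circular Gaussians\<close>

context prob_space
begin

text \<open>The rotated real part is cos \<phi> Re Z - sin \<phi> Im Z, a sum of independent centred
  normals whose variances add up to (cos^2 + sin^2) v/2 = v/2.\<close>

lemma distributed_Re_rotation:
  assumes Z: "circular_gaussian v Z" and "v > 0"
  shows "distributed M lborel (\<lambda>\<omega>. Re (cis \<phi> * Z \<omega>)) (normal_density 0 (sqrt (v / 2)))"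
proof -
  define s where "s = sqrt (v / 2)"
  have "s > 0" using \<open>v > 0\<close> by (simp add: s_def)
  have ind: "indep_var borel (\<lambda>\<omega>. Re (Z \<omega>)) borel (\<lambda>\<omega>. Im (Z \<omega>))"
    and R: "distributed M lborel (\<lambda>\<omega>. Re (Z \<omega>)) (normal_density 0 s)"
    and I: "distributed M lborel (\<lambda>\<omega>. Im (Z \<omega>)) (normal_density 0 s)"
    using Z by (auto simp: circular_gaussian_def s_def)
  have R': "distributed M lborel (\<lambda>\<omega>. cos \<phi> * Re (Z \<omega>)) (normal_density 0 (\<bar>cos \<phi>\<bar> * s))"
    if "cos \<phi> \<noteq> 0"
    using normal_density_affine[OF R \<open>s > 0\<close> that, of 0] by simp
  have I': "distributed M lborel (\<lambda>\<omega>. - sin \<phi> * Im (Z \<omega>)) (normal_density 0 (\<bar>sin \<phi>\<bar> * s))"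
    if "sin \<phi> \<noteq> 0"
    using normal_density_affine[OF I \<open>s > 0\<close>, of "- sin \<phi>" 0] that by simp
  have "distributed M lborel (\<lambda>\<omega>. cos \<phi> * Re (Z \<omega>) + - sin \<phi> * Im (Z \<omega>)) (normal_density 0 s)"
  \<comment> \<open>A term with coefficient 0 is constant and has no density, so the multiples of
    pi/2 are treated apart from the sum rule for normals.\<close>
  proof (cases "cos \<phi> = 0")
    case True
    then have "\<bar>sin \<phi>\<bar> = 1"
      using sin_cos_squared_add[of \<phi>] by (auto simp: True power2_eq_1_iff)
    then show ?thesis using I' True by auto
  next
    case c: False
    show ?thesis
    proof (cases "sin \<phi> = 0")
      case True
      then have "\<bar>cos \<phi>\<bar> = 1" by (rule sin_zero_abs_cos_one)
      then show ?thesis using R' True by auto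
    next
      case False
      have "indep_var borel ((\<lambda>x. cos \<phi> * x) \<circ> (\<lambda>\<omega>. Re (Z \<omega>))) borel ((\<lambda>x. - sin \<phi> * x) \<circ> (\<lambda>\<omega>. Im (Z \<omega>)))"
        by (rule indep_var_compose[OF ind]) auto
      then have "distributed M lborel (\<lambda>\<omega>. cos \<phi> * Re (Z \<omega>) + - sin \<phi> * Im (Z \<omega>))
          (normal_density (0 + 0) (sqrt ((\<bar>cos \<phi>\<bar> * s)\<^sup>2 + (\<bar>sin \<phi>\<bar> * s)\<^sup>2)))"
        using c False \<open>s > 0\<close> R' I' by (intro add_indep_normal) (auto simp: o_def)
      moreover have "(\<bar>cos \<phi>\<bar> * s)\<^sup>2 + (\<bar>sin \<phi>\<bar> * s)\<^sup>2 = s\<^sup>2"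
        by (simp add: power_mult_distrib flip: distrib_right)
      ultimately show ?thesis using \<open>s > 0\<close> by simp
    qed
  qed
  then show ?thesis by (simp add: s_def)
qed

text \<open>Stated for the nonnegative integral, so that it can be inserted after an exchange of
  integrals before any integrability is known.\<close>

lemma nn_integral_abs_normal:
  assumes X: "distributed M lborel X (normal_density 0 s)" and "s > 0"
  shows "(\<integral>\<^sup>+\<omega>. ennreal \<bar>X \<omega>\<bar> \<partial>M) = ennreal (s * sqrt (2 / pi))"
proof -
  have "(\<integral>\<^sup>+\<omega>. ennreal \<bar>X \<omega>\<bar> \<partial>M) = (\<integral>\<^sup>+x. ennreal (normal_density 0 s x) * ennreal \<bar>x\<bar> \<partial>lborel)"
    by (subst distributed_nn_integral[OF X, of "\<lambda>x. ennreal \<bar>x\<bar>"]) auto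
  also have "\<dots> = (\<integral>\<^sup>+x. ennreal (normal_density 0 s x * \<bar>x\<bar>) \<partial>lborel)"
    by (simp add: ennreal_mult)
  also have "\<dots> = ennreal (s * sqrt (2 / pi))"
    using normal_moment_abs_odd[OF \<open>s > 0\<close>, of 0 0] \<open>s > 0\<close>
    by (subst nn_integral_eq_integral) (auto simp: has_bochner_integral_iff)
  finally show ?thesis .
qed

text \<open>The weights may vanish, so that one may perturb a combination in a direction that does not
  occur in it.\<close>

lemma distributed_Re_rotation_sum:
  assumes "finite I" and h: "indep_vars (\<lambda>_. borel) h I"
    and g: "\<And>i. i \<in> I \<Longrightarrow> circular_gaussian 1 (h i)" and pos: "(\<Sum>i\<in>I. (w i)\<^sup>2) > 0"
  shows "distributed M lborel (\<lambda>\<omega>. Re (cis \<phi> * (\<Sum>i\<in>I. of_real (w i) * h i \<omega>)))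
    (normal_density 0 (sqrt ((\<Sum>i\<in>I. (w i)\<^sup>2) / 2)))"
proof -
  \<comment> \<open>Terms of weight 0 are point masses without density, so the sum rule for normals
    is applied to the remaining ones; \<open>pos\<close> guarantees that some remain.\<close>
  define J where "J = {i\<in>I. w i \<noteq> 0}"
  have J: "finite J" "J \<subseteq> I" using \<open>finite I\<close> by (auto simp: J_def)
  have w2: "(\<Sum>i\<in>I. (w i)\<^sup>2) = (\<Sum>i\<in>J. (w i)\<^sup>2)"
    using \<open>finite I\<close> by (intro sum.mono_neutral_right) (auto simp: J_def)
  then have "J \<noteq> {}" using pos by auto
  have d: "distributed M lborel (\<lambda>\<omega>. w i * Re (cis \<phi> * h i \<omega>)) (normal_density 0 (\<bar>w i\<bar> * sqrt (1/2)))"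
    if "i \<in> J" for i
  proof -
    have "distributed M lborel (\<lambda>\<omega>. Re (cis \<phi> * h i \<omega>)) (normal_density 0 (sqrt (1/2)))"
      using g[of i] that by (intro distributed_Re_rotation) (auto simp: J_def)
    from normal_density_affine[OF this, of "w i" 0] show ?thesis
      using that by (auto simp: J_def)
  qed
  have "indep_vars (\<lambda>_. borel) (\<lambda>i \<omega>. w i * Re (cis \<phi> * h i \<omega>)) J"
    by (rule indep_vars_compose2[OF indep_vars_subset[OF h J(2)], where Y = "\<lambda>i z. w i * Re (cis \<phi> * z)"])
       (auto intro!: borel_measurable_continuous_onI continuous_intros)
  then have "distributed M lborel (\<lambda>\<omega>. \<Sum>i\<in>J. w i * Re (cis \<phi> * h i \<omega>))
     (normal_density (\<Sum>i\<in>J. 0) (sqrt (\<Sum>i\<in>J. (\<bar>w i\<bar> * sqrt (1/2))\<^sup>2)))"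
    using J \<open>J \<noteq> {}\<close> d by (intro sum_indep_normal) (auto simp: J_def)
  also have "(\<Sum>i\<in>J. (\<bar>w i\<bar> * sqrt (1/2))\<^sup>2) = (\<Sum>i\<in>I. (w i)\<^sup>2) / 2"
    by (simp add: w2 power_mult_distrib sum_divide_distrib)
  also have "(\<lambda>\<omega>. \<Sum>i\<in>J. w i * Re (cis \<phi> * h i \<omega>)) = 
      (\<lambda>\<omega>. Re (cis \<phi> * (\<Sum>i\<in>I. of_real (w i) * h i \<omega>)))"
  proof
    fix \<omega>
    have "(\<Sum>i\<in>I. of_real (w i) * h i \<omega>) = (\<Sum>i\<in>J. of_real (w i) * h i \<omega>)"
      using \<open>finite I\<close> by (intro sum.mono_neutral_right) (auto simp: J_def)
    then show "(\<Sum>i\<in>J. w i * Re (cis \<phi> * h i \<omega>)) = Re (cis \<phi> * (\<Sum>i\<in>I. of_real (w i) * h i \<omega>))"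
      by (simp add: sum_distrib_left sum_subtractf algebra_simps)
  qed
  finally show ?thesis by simp
qed

text \<open>Tonelli turns 2 E|T| into the integral over \<phi> in [0, pi] of E|Re(e^{i\<phi>} T)|,
  so only one-dimensional normal laws enter, all with the same parameters. Integrability comes at
  the end, from finiteness of the nonnegative integral.\<close>

lemma expectation_cmod_gaussian_sum:
  assumes "finite I" and h: "indep_vars (\<lambda>_. borel) h I"
    and g: "\<And>i. i \<in> I \<Longrightarrow> circular_gaussian 1 (h i)" and pos: "(\<Sum>i\<in>I. (w i)\<^sup>2) > 0"
  shows "has_bochner_integral M (\<lambda>\<omega>. cmod (\<Sum>i\<in>I. of_real (w i) * h i \<omega>))
    (sqrt pi / 2 * sqrt (\<Sum>i\<in>I. (w i)\<^sup>2))"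
proof -
  define T where "T \<omega> = (\<Sum>i\<in>I. of_real (w i) * h i \<omega>)" for \<omega>
  define W where "W = sqrt (\<Sum>i\<in>I. (w i)\<^sup>2)"
  have "W > 0" using pos by (simp add: W_def)
  have [measurable]: "h i \<in> borel_measurable M" if "i \<in> I" for i
    using h that by (auto simp: indep_vars_def)
  have [measurable]: "T \<in> borel_measurable M"
    unfolding T_def by measurable
  have [measurable]: "cis \<in> borel_measurable borel"
    by (intro borel_measurable_continuous_onI continuous_intros)
  interpret pair_sigma_finite M lborel ..
  have "2 * (\<integral>\<^sup>+\<omega>. cmod (T \<omega>) \<partial>M) = (\<integral>\<^sup>+\<omega>. ennreal (2 * cmod (T \<omega>)) \<partial>M)"
    by (simp add: ennreal_mult nn_integral_cmult)
  also have "\<dots> = (\<integral>\<^sup>+\<omega>. (\<integral>\<^sup>+\<phi>. ennreal \<bar>Re (cis \<phi> * T \<omega>)\<bar> * indicator {0..pi} \<phi> \<partial>lborel) \<partial>M)"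
    by (simp only: cmod_eq_average_Re_rotations)
  also have "\<dots> = (\<integral>\<^sup>+\<phi>. (\<integral>\<^sup>+\<omega>. ennreal \<bar>Re (cis \<phi> * T \<omega>)\<bar> * indicator {0..pi} \<phi> \<partial>M) \<partial>lborel)"
    by (rule Fubini'[symmetric]) measurable
  also have "\<dots> = (\<integral>\<^sup>+\<phi>. ennreal (W / sqrt 2 * sqrt (2 / pi)) * indicator {0..pi} \<phi> \<partial>lborel)"
  proof (rule nn_integral_cong)
    fix \<phi> :: real
    have "distributed M lborel (\<lambda>\<omega>. Re (cis \<phi> * T \<omega>)) (normal_density 0 (W / sqrt 2))"
      using distributed_Re_rotation_sum[OF assms, of \<phi>]
      by (simp add: T_def W_def real_sqrt_divide)
    from nn_integral_abs_normal[OF this] \<open>W > 0\<close>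
    have "(\<integral>\<^sup>+\<omega>. ennreal \<bar>Re (cis \<phi> * T \<omega>)\<bar> \<partial>M) = ennreal (W / sqrt 2 * sqrt (2 / pi))"
      by simp
    then show "(\<integral>\<^sup>+\<omega>. ennreal \<bar>Re (cis \<phi> * T \<omega>)\<bar> * indicator {0..pi} \<phi> \<partial>M) =
        ennreal (W / sqrt 2 * sqrt (2 / pi)) * indicator {0..pi} \<phi>"
      by (subst nn_integral_multc) auto
  qed
  also have "\<dots> = ennreal (W / sqrt 2 * sqrt (2 / pi)) * ennreal pi"
    by (subst nn_integral_cmult_indicator) auto
  \<comment> \<open>Each angle contributes W / sqrt pi, hence sqrt pi * W over an interval of length
    pi.\<close>
  also have "\<dots> = ennreal (2 * (sqrt pi / 2 * W))"
    using \<open>W > 0\<close> by (simp add: real_sqrt_divide real_div_sqrt flip: ennreal_mult) (simp add: field_simps)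
  also have "\<dots> = 2 * ennreal (sqrt pi / 2 * W)"
    using \<open>W > 0\<close> by (subst ennreal_mult) auto
  finally have "(\<integral>\<^sup>+\<omega>. cmod (T \<omega>) \<partial>M) = ennreal (sqrt pi / 2 * W)"
    by (simp add: ennreal_mult_cancel_left)
  then show ?thesis
    using \<open>W > 0\<close> unfolding T_def[symmetric] W_def[symmetric]
    by (intro has_bochner_integral_nn_integral) auto
qed

text \<open>The integrand is the derivative at $t = 0$ of $|\sum_i w_i h_i + t h_k|$, whose expectation
  is known for every $t$.\<close>

lemma expectation_phase_aligned:
  assumes "finite I" and h: "indep_vars (\<lambda>_. borel) h I"
    and g: "\<And>i. i \<in> I \<Longrightarrow> circular_gaussian 1 (h i)" and pos: "(\<Sum>i\<in>I. (w i)\<^sup>2) > 0"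
    and "k \<in> I" and "w k \<ge> 0"
  shows "has_bochner_integral M
    (\<lambda>\<omega>. Re (cis (Arg (cnj (\<Sum>i\<in>I. of_real (w i) * h i \<omega>))) * h k \<omega>))
    (sqrt pi / 2 * (w k / sqrt (\<Sum>i\<in>I. (w i)\<^sup>2)))"
proof -
  define T where "T \<omega> = (\<Sum>i\<in>I. of_real (w i) * h i \<omega>)" for \<omega>
  define W where "W = sqrt (\<Sum>i\<in>I. (w i)\<^sup>2)"
  \<comment> \<open>The sum of squares after the weight \<open>w k\<close> has been raised to
    \<open>w k + t\<close>.\<close>
  define q where "q t = W\<^sup>2 + 2 * t * w k + t\<^sup>2" for t
  \<comment> \<open>A sequence of positive steps tending to 0, as dominated convergence is applied
    to sequences. With \<open>w k \<ge> 0\<close> a positive step keeps \<open>q\<close>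
    positive.\<close>
  define \<epsilon> where "\<epsilon> j = inverse (real (Suc j))" for j
  have "W > 0" using pos by (simp add: W_def)
  have \<epsilon>: "\<epsilon> j > 0" for j by (simp add: \<epsilon>_def)
  have [measurable]: "h i \<in> borel_measurable M" if "i \<in> I" for i
    using h that by (auto simp: indep_vars_def)
  have [measurable]: "T \<in> borel_measurable M" "h k \<in> borel_measurable M"
    using \<open>k \<in> I\<close> unfolding T_def by measurable
  have ET: "has_bochner_integral M (\<lambda>\<omega>. cmod (T \<omega>)) (sqrt pi / 2 * W)"
    using expectation_cmod_gaussian_sum[OF assms(1-4)] by (simp add: T_def W_def)
  \<comment> \<open>The dominating function below; \<open>h k\<close> is itself a weighted sum, over
    a singleton with weight 1.\<close>
  have Ehk: "integrable M (\<lambda>\<omega>. cmod (h k \<omega>))"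
    using expectation_cmod_gaussian_sum[OF _ indep_vars_subset[OF h], of "{k}" "\<lambda>_. 1"] g \<open>k \<in> I\<close>
    by (auto simp: has_bochner_integral_iff)
  have ETt: "has_bochner_integral M (\<lambda>\<omega>. cmod (T \<omega> + t *\<^sub>R h k \<omega>)) (sqrt pi / 2 * sqrt (q t))"
    if "t > 0" for t
  proof -
    let ?w = "w(k := w k + t)"
    have s1: "(\<Sum>i\<in>I. (?w i)\<^sup>2) = q t"
    proof -
      have "(\<Sum>i\<in>I. (?w i)\<^sup>2) = (w k + t)\<^sup>2 + (\<Sum>i\<in>I - {k}. (w i)\<^sup>2)"
        using \<open>finite I\<close> \<open>k \<in> I\<close> by (subst sum.remove[of _ k]) (auto intro!: sum.cong)
      moreover have "W\<^sup>2 = (w k)\<^sup>2 + (\<Sum>i\<in>I - {k}. (w i)\<^sup>2)"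
        using pos \<open>finite I\<close> \<open>k \<in> I\<close> by (simp add: W_def sum.remove[of _ k])
      ultimately show ?thesis by (simp add: q_def power2_sum)
    qed
    have s2: "(\<Sum>i\<in>I. of_real (?w i) * h i \<omega>) = T \<omega> + t *\<^sub>R h k \<omega>" for \<omega>
    proof -
      have "(\<Sum>i\<in>I. of_real (?w i) * h i \<omega>) =
          of_real (w k + t) * h k \<omega> + (\<Sum>i\<in>I - {k}. of_real (w i) * h i \<omega>)"
        using \<open>finite I\<close> \<open>k \<in> I\<close> by (subst sum.remove[of _ k]) (auto intro!: sum.cong)
      moreover have "T \<omega> = of_real (w k) * h k \<omega> + (\<Sum>i\<in>I - {k}. of_real (w i) * h i \<omega>)"
        using \<open>finite I\<close> \<open>k \<in> I\<close> by (simp add: T_def sum.remove[of _ k])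
      ultimately show ?thesis by (simp add: algebra_simps scaleR_conv_of_real)
    qed
    have "q t > 0"
      using that \<open>W > 0\<close> \<open>w k \<ge> 0\<close> by (auto simp: q_def intro!: add_pos_nonneg)
    then show ?thesis
      using expectation_cmod_gaussian_sum[OF assms(1-3), of ?w] unfolding s1 s2 by simp
  qed
  \<comment> \<open>The norm is not differentiable at 0. Since Re T (rotation by the angle 0) has a
    density, T vanishes with probability 0.\<close>
  have ne: "AE \<omega> in M. T \<omega> \<noteq> 0"
  proof -
    have D: "distributed M lborel (\<lambda>\<omega>. Re (T \<omega>)) (normal_density 0 (sqrt (W\<^sup>2 / 2)))"
      using distributed_Re_rotation_sum[OF assms(1-4), of 0] pos by (simp add: T_def W_def)
    have "AE x in lborel. x \<noteq> (0::real)"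
      by (rule AE_lborel_singleton)
    then have "AE \<omega> in M. Re (T \<omega>) \<noteq> 0"
      by (subst distributed_AE2[OF D]) auto
    then show ?thesis by eventually_elim auto
  qed
  define s where "s j \<omega> = (cmod (T \<omega> + \<epsilon> j *\<^sub>R h k \<omega>) - cmod (T \<omega>)) / \<epsilon> j" for j \<omega>
  have [measurable]: "s j \<in> borel_measurable M" for j
    unfolding s_def by measurable
  have lim: "(\<lambda>j. (f (\<epsilon> j) - f 0) / \<epsilon> j) \<longlonglongrightarrow> D" if "(f has_real_derivative D) (at 0)" for f D
  proof -
    have "filterlim \<epsilon> (at 0) sequentially"
      using LIMSEQ_inverse_real_of_nat by (simp add: filterlim_at \<epsilon>_def[abs_def])
    moreover have "((\<lambda>t. (f t - f 0) / t) \<longlongrightarrow> D) (at 0)"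
      using that by (simp add: DERIV_def)
    ultimately show ?thesis by (rule filterlim_compose[rotated])
  qed
  \<comment> \<open>The derivative of the norm at T \<noteq> 0 in direction x is the inner product
    of \<open>sgn T\<close> with x.\<close>
  have s_lim: "AE \<omega> in M. (\<lambda>j. s j \<omega>) \<longlonglongrightarrow> sgn (T \<omega>) \<bullet> h k \<omega>"
    using ne
  proof eventually_elim
    case (elim \<omega>)
    have "((\<lambda>t. T \<omega> + t *\<^sub>R h k \<omega>) has_derivative (\<lambda>t. t *\<^sub>R h k \<omega>)) (at 0)"
      by (auto intro!: derivative_eq_intros)
    from has_derivative_compose[OF this, of norm "\<lambda>x. x \<bullet> sgn (T \<omega>)"] has_derivative_norm[OF elim]
    have "((\<lambda>t. cmod (T \<omega> + t *\<^sub>R h k \<omega>)) has_derivative (\<lambda>t. (t *\<^sub>R h k \<omega>) \<bullet> sgn (T \<omega>))) (at 0)"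
      by simp
    then have "((\<lambda>t. cmod (T \<omega> + t *\<^sub>R h k \<omega>)) has_real_derivative sgn (T \<omega>) \<bullet> h k \<omega>) (at 0)"
      by (simp add: has_field_derivative_def inner_commute mult_commute_abs)
    from lim[OF this] show ?case by (simp add: s_def)
  qed
  \<comment> \<open>The norm is 1-Lipschitz, so every difference quotient is bounded by |h_k|,
    uniformly in j.\<close>
  have s_bound: "AE \<omega> in M. norm (s j \<omega>) \<le> cmod (h k \<omega>)" for j
  proof (rule AE_I2)
    fix \<omega>
    have "\<bar>cmod (T \<omega> + \<epsilon> j *\<^sub>R h k \<omega>) - cmod (T \<omega>)\<bar> \<le> \<epsilon> j * cmod (h k \<omega>)"
      using norm_triangle_ineq3[of "T \<omega> + \<epsilon> j *\<^sub>R h k \<omega>" "T \<omega>"] \<epsilon>[of j] by simp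
    then show "norm (s j \<omega>) \<le> cmod (h k \<omega>)"
      using \<epsilon>[of j] by (simp add: s_def field_simps)
  qed
  note dom = integrable_dominated_convergence[OF _ _ Ehk s_lim s_bound]
    integral_dominated_convergence[OF _ _ Ehk s_lim s_bound]
  have int: "integrable M (\<lambda>\<omega>. sgn (T \<omega>) \<bullet> h k \<omega>)"
    by (rule dom) measurable
  have "integral\<^sup>L M (s j) = sqrt pi / 2 * ((sqrt (q (\<epsilon> j)) - sqrt (q 0)) / \<epsilon> j)" for j
  proof -
    have "sqrt (q 0) = W" using \<open>W > 0\<close> by (simp add: q_def)
    moreover have "has_bochner_integral M (s j)
        ((sqrt pi / 2 * sqrt (q (\<epsilon> j)) - sqrt pi / 2 * W) / \<epsilon> j)"
      unfolding s_def
      by (intro has_bochner_integral_divide_zero has_bochner_integral_diff ET ETt \<epsilon>)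
    ultimately show ?thesis
      by (simp add: has_bochner_integral_iff right_diff_distrib)
  qed
  moreover have "(\<lambda>j. sqrt pi / 2 * ((sqrt (q (\<epsilon> j)) - sqrt (q 0)) / \<epsilon> j)) \<longlonglongrightarrow> sqrt pi / 2 * (w k / W)"
  proof (intro tendsto_mult tendsto_const lim)
    \<comment> \<open>q'(0) / (2 sqrt(q(0))) = 2 w_k / (2 W).\<close>
    show "((\<lambda>t. sqrt (q t)) has_real_derivative w k / W) (at 0)"
      unfolding q_def using \<open>W > 0\<close> by (auto intro!: derivative_eq_intros simp: field_simps)
  qed
  moreover have "(\<lambda>j. integral\<^sup>L M (s j)) \<longlonglongrightarrow> (\<integral>\<omega>. sgn (T \<omega>) \<bullet> h k \<omega> \<partial>M)"
    by (rule dom) measurable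
  ultimately have "(\<integral>\<omega>. sgn (T \<omega>) \<bullet> h k \<omega> \<partial>M) = sqrt pi / 2 * (w k / W)"
    by (simp add: LIMSEQ_unique)
  with int have "has_bochner_integral M (\<lambda>\<omega>. sgn (T \<omega>) \<bullet> h k \<omega>) (sqrt pi / 2 * (w k / W))"
    by (simp add: has_bochner_integral_iff)
  \<comment> \<open>For T \<noteq> 0, \<open>cis (Arg (cnj T))\<close> is the conjugate of
    \<open>sgn T\<close>, and Re(cnj a * b) is the real inner product. At T = 0 the conventions for
    \<open>Arg\<close> and \<open>sgn\<close> disagree, hence almost everywhere.\<close>
  moreover have "AE \<omega> in M. sgn (T \<omega>) \<bullet> h k \<omega> = Re (cis (Arg (cnj (T \<omega>))) * h k \<omega>)"
    using ne by eventually_elim (simp add: cis_Arg inner_complex_def sgn_div_norm distrib_left)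
  moreover have "(\<lambda>\<omega>. Re (cis (Arg (cnj (T \<omega>))) * h k \<omega>)) \<in> borel_measurable M"
    by measurable
  ultimately show ?thesis
    unfolding T_def[symmetric] W_def[symmetric]
    by (subst has_bochner_integral_cong_AE[symmetric]) auto
qed

text \<open>Here h_j plays the part of an entry of \<open>h\<^sub>p\<close>. It is independent of
  the whole family over I, so the expectation factors, and (sqrt pi / 2)^2 = pi / 4.\<close>

lemma expectation_cmod_mult_phase_aligned:
  assumes h: "indep_vars (\<lambda>_. borel) h (insert j I)" and "j \<notin> I" "finite I"
    and g: "\<And>i. i \<in> insert j I \<Longrightarrow> circular_gaussian 1 (h i)" and pos: "(\<Sum>i\<in>I. (w i)\<^sup>2) > 0"
    and "k \<in> I" and "w k \<ge> 0"
  shows "has_bochner_integral M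
    (\<lambda>\<omega>. cmod (h j \<omega>) * Re (cis (Arg (cnj (\<Sum>i\<in>I. of_real (w i) * h i \<omega>))) * h k \<omega>))
    (pi / 4 * (w k / sqrt (\<Sum>i\<in>I. (w i)\<^sup>2)))"
proof -
  let ?f = "\<lambda>x. Re (cis (Arg (cnj (\<Sum>i\<in>I. of_real (w i) * x i))) * x k)"
  have hI: "indep_vars (\<lambda>_. borel) h I" and hj: "indep_vars (\<lambda>_. borel) h {j}"
    by (auto intro: indep_vars_subset[OF h])
  \<comment> \<open>The second factor depends on all h_i at once, through the phase, so independence
    is needed between tuples rather than between single variables.\<close>
  have "indep_var (PiM {j} (\<lambda>_. borel)) (\<lambda>\<omega>. restrict (\<lambda>i. h i \<omega>) {j})
      (PiM I (\<lambda>_. borel)) (\<lambda>\<omega>. restrict (\<lambda>i. h i \<omega>) I)"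
    using \<open>j \<notin> I\<close> by (intro indep_var_restrict[OF h]) auto
  moreover have "(\<lambda>x. cmod (x j)) \<in> borel_measurable (PiM {j} (\<lambda>_. borel))"
    by measurable
  moreover have "?f \<in> borel_measurable (PiM I (\<lambda>_. borel))"
    using \<open>k \<in> I\<close> by measurable
  ultimately have "indep_var borel ((\<lambda>x. cmod (x j)) \<circ> (\<lambda>\<omega>. restrict (\<lambda>i. h i \<omega>) {j}))
      borel (?f \<circ> (\<lambda>\<omega>. restrict (\<lambda>i. h i \<omega>) I))"
    by (rule indep_var_compose)
  then have ind: "indep_var borel (\<lambda>\<omega>. cmod (h j \<omega>)) borel (\<lambda>\<omega>. ?f (\<lambda>i. h i \<omega>))"
    using \<open>k \<in> I\<close> by (simp add: o_def)
  have 1: "has_bochner_integral M (\<lambda>\<omega>. cmod (h j \<omega>)) (sqrt pi / 2)"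
    using expectation_cmod_gaussian_sum[OF _ hj, of "\<lambda>_. 1"] g by simp
  have sqrt_pi: "sqrt pi / 2 * (sqrt pi / 2 * x) = pi / 4 * x" for x
    by (simp add: mult.assoc[symmetric])
  have 2: "has_bochner_integral M (\<lambda>\<omega>. ?f (\<lambda>i. h i \<omega>)) (sqrt pi / 2 * (w k / sqrt (\<Sum>i\<in>I. (w i)\<^sup>2)))"
    using g pos assms by (intro expectation_phase_aligned hI) auto
  show ?thesis
    using 1 2 indep_var_integrable[OF ind] indep_var_lebesgue_integral[OF ind]
    unfolding has_bochner_integral_iff by (simp only: sqrt_pi simp_thms)
qed

end

section \<open>The aggregation coefficients under the prescribed phases\<close>

lemma aggregation_coeff_eq_sum:
  "aggregation_coeff b q l \<theta> x y =
     b * sqrt q / l * (\<Sum>n\<in>UNIV. Re (cnj (x $ n) * (cis (\<theta> $ n) * y $ n)))"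
proof -
  have "(reflecting_matrix \<theta> *v y) $ n = cis (\<theta> $ n) * y $ n" for n
    by (simp add: reflecting_matrix_def matrix_vector_mult_def if_distrib[where f = "\<lambda>a. a * _"]
        cong: if_cong)
  then show ?thesis
    by (simp add: aggregation_coeff_def hermitian_product_def)
qed

text \<open>The phase shift cancels the argument of \<open>cnj z\<close> and leaves its modulus
  rotated by a. A congruence is enough because \<open>cis\<close> has period 2 pi; for z = 0 both
  sides vanish.\<close>

lemma cnj_mult_cis_aligned:
  assumes "[\<theta> = - Arg (cnj z) + a] (rmod (2 * pi))"
  shows "cnj z * cis \<theta> = of_real (cmod z) * cis a"
proof -
  obtain m where m: "- Arg (cnj z) + a = \<theta> + of_int m * (2 * pi)"
    using assms by (auto simp: rcong_altdef)
  have "cis \<theta> = cis (\<theta> + of_int m * (2 * pi))"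
    using cis_multiple_2pi[of "of_int m"] by (simp add: cis_mult[symmetric] mult_ac)
  also have "\<dots> = cis (- Arg (cnj z)) * cis a"
    by (simp add: m[symmetric] cis_mult)
  finally have "cnj z * cis \<theta> = rcis (cmod (cnj z)) (Arg (cnj z)) * (cis (- Arg (cnj z)) * cis a)"
    by (simp only: rcis_cmod_Arg)
  also have "\<dots> = of_real (cmod z) * cis a"
    by (simp add: rcis_def cis_mult)
  finally show ?thesis .
qed

theorem theorem1:
  fixes P :: "'a measure"
    and K M :: nat
    and h\<^sub>p :: "'a \<Rightarrow> complex ^ 'n"
    and h\<^sub>r :: "nat \<Rightarrow> 'a \<Rightarrow> complex ^ 'n"
    and \<theta> :: "'a \<Rightarrow> real ^ 'n"
    and \<beta> p w :: "nat \<Rightarrow> real"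
    and l :: real
    and ell :: "nat \<Rightarrow> 'a \<Rightarrow> real"
  defines "ell \<equiv> (\<lambda>i \<omega>. aggregation_coeff (\<beta> i) (p i) l (\<theta> \<omega>) (h\<^sub>p \<omega>) (h\<^sub>r i \<omega>))"
  assumes "prob_space P"
    and "K \<ge> 1" and "M \<ge> 1"
    and "prob_space.indep_vars P (\<lambda>_. borel) (case_option h\<^sub>p h\<^sub>r)
           (insert None (Some ` {1..K + M}))"
    and "prob_space.standard_complex_gaussian_vector P h\<^sub>p"
    and "\<And>i. i \<in> {1..K + M} \<Longrightarrow> prob_space.standard_complex_gaussian_vector P (h\<^sub>r i)"
    and "\<And>i. i \<in> {1..K + M} \<Longrightarrow> \<beta> i > 0"
    and "\<And>i. i \<in> {1..K + M} \<Longrightarrow> p i > 0"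
    and "l > 0"
    and "\<And>k. k \<in> {1..K} \<Longrightarrow> w k > 0"
    and "\<And>\<omega> n. \<omega> \<in> space P \<Longrightarrow>
           [\<theta> \<omega> $ n = - Arg (cnj (h\<^sub>p \<omega> $ n))
              + Arg (\<Sum>k\<in>{1..K}. of_real (w k) * cnj (h\<^sub>r k \<omega> $ n))] (rmod (2 * pi))"
  shows "(\<forall>k\<in>{1..K}. integrable P (ell k) \<and>
            integral\<^sup>L P (ell k) =
              pi * real CARD('n) * \<beta> k * sqrt (p k) * w k / (4 * l * sqrt (\<Sum>i\<in>{1..K}. (w i)\<^sup>2))) \<and>
         (\<forall>m\<in>{K + 1..K + M}. integrable P (ell m) \<and> integral\<^sup>L P (ell m) = 0)"
proof -
  interpret prob_space P by fact
  let ?X = "case_option h\<^sub>p h\<^sub>r" and ?I = "Some ` {1..K + M}"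
  note indep = assms(5) and gauss_p = assms(6) and gauss_r = assms(7) and phases = assms(12)
  \<comment> \<open>Weight 0 makes the interferers formal members of the combination, so that
    \<open>main\<close> covers devices and interferers alike. \<open>None\<close> stands for
    \<open>h\<^sub>p\<close>.\<close>
  define v :: "nat option \<Rightarrow> real" where "v = case_option 0 (\<lambda>i. if i \<le> K then w i else 0)"
  \<comment> \<open>Polymorphic in the summands: used for the real squares and for the complex
    combination.\<close>
  have sum_I: "(\<Sum>i\<in>?I. f i) = (\<Sum>k\<in>{1..K}. f (Some k))"
    if "\<And>k. k > K \<Longrightarrow> f (Some k) = 0" for f :: "nat option \<Rightarrow> 'b::comm_monoid_add"
    using that by (subst sum.reindex) (auto intro!: sum.mono_neutral_right)
  have v2: "(\<Sum>i\<in>?I. (v i)\<^sup>2) = (\<Sum>k\<in>{1..K}. (w k)\<^sup>2)"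
    by (subst sum_I) (auto simp: v_def)
  have "(\<Sum>k\<in>{1..K}. (w k)\<^sup>2) > 0"
    using \<open>K \<ge> 1\<close> assms(11) by (intro sum_pos) force+
  have main: "has_bochner_integral P (ell i) (\<beta> i * sqrt (p i) / l *
      (real CARD('n) * (pi / 4 * (v (Some i) / sqrt (\<Sum>k\<in>{1..K}. (w k)\<^sup>2)))))"
    if i: "i \<in> {1..K + M}" for i
  proof -
    \<comment> \<open>The n-th summand after phase cancellation. It does not mention \<theta>, whose
      measurability is not assumed; the integrability of \<open>ell i\<close> is obtained from its
      agreement with a multiple of the sum of these terms on \<open>space P\<close>.\<close>
    define f where "f n \<omega> = cmod (h\<^sub>p \<omega> $ n) *
      Re (cis (Arg (cnj (\<Sum>k\<in>?I. of_real (v k) * ?X k \<omega> $ n))) * h\<^sub>r i \<omega> $ n)" for n \<omega>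
    have "has_bochner_integral P (f n) (pi / 4 * (v (Some i) / sqrt (\<Sum>k\<in>{1..K}. (w k)\<^sup>2)))" for n
    proof -
      have "indep_vars (\<lambda>_. borel) (\<lambda>k \<omega>. ?X k \<omega> $ n) (insert None ?I)"
        by (rule indep_vars_compose2[OF indep, where Y = "\<lambda>_ x. x $ n"])
           (auto intro!: borel_measurable_continuous_onI continuous_intros)
      moreover have "circular_gaussian 1 (\<lambda>\<omega>. ?X k \<omega> $ n)" if "k \<in> insert None ?I" for k
        using that gauss_p gauss_r by (auto simp: standard_complex_gaussian_vector_def)
      moreover have "v (Some i) \<ge> 0"
        using i assms(11)[of i] by (auto simp: v_def intro: less_imp_le)
      ultimately show ?thesis
        using expectation_cmod_mult_phase_aligned[of "\<lambda>k \<omega>. ?X k \<omega> $ n" None ?I v "Some i"]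
          i \<open>(\<Sum>k\<in>{1..K}. (w k)\<^sup>2) > 0\<close>
        unfolding v2 f_def by (auto simp: image_iff)
    qed
    then have "has_bochner_integral P (\<lambda>\<omega>. \<beta> i * sqrt (p i) / l * (\<Sum>n\<in>UNIV. f n \<omega>))
        (\<beta> i * sqrt (p i) / l *
          (\<Sum>n\<in>(UNIV :: 'n set). pi / 4 * (v (Some i) / sqrt (\<Sum>k\<in>{1..K}. (w k)\<^sup>2))))"
      by (intro has_bochner_integral_mult_right has_bochner_integral_sum)
    moreover have "ell i \<omega> = \<beta> i * sqrt (p i) / l * (\<Sum>n\<in>UNIV. f n \<omega>)" if "\<omega> \<in> space P" for \<omega>
    proof -
      have "Re (cnj (h\<^sub>p \<omega> $ n) * (cis (\<theta> \<omega> $ n) * h\<^sub>r i \<omega> $ n)) = f n \<omega>" for n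
      proof -
        have "(\<Sum>k\<in>?I. of_real (v k) * ?X k \<omega> $ n) = (\<Sum>k\<in>{1..K}. of_real (w k) * h\<^sub>r k \<omega> $ n)"
          by (subst sum_I) (auto simp: v_def)
        moreover have "cnj (h\<^sub>p \<omega> $ n) * cis (\<theta> \<omega> $ n) = of_real (cmod (h\<^sub>p \<omega> $ n)) *
            cis (Arg (cnj (\<Sum>k\<in>{1..K}. of_real (w k) * h\<^sub>r k \<omega> $ n)))"
          using cnj_mult_cis_aligned[OF phases[OF that, of n]] by simp
        ultimately show ?thesis
          by (simp add: f_def mult.assoc[symmetric]) (simp add: algebra_simps)
      qed
      then show ?thesis by (simp add: ell_def aggregation_coeff_eq_sum)
    qed
    ultimately show ?thesis by (subst has_bochner_integral_cong[OF refl _ refl]) auto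
  qed
  show ?thesis
  proof (intro conjI ballI)
    fix k assume "k \<in> {1..K}"
    then show "integrable P (ell k)" "integral\<^sup>L P (ell k) =
        pi * real CARD('n) * \<beta> k * sqrt (p k) * w k / (4 * l * sqrt (\<Sum>i\<in>{1..K}. (w i)\<^sup>2))"
      using main[of k] by (auto simp: has_bochner_integral_iff v_def mult_ac)
  next
    fix m assume "m \<in> {K + 1..K + M}"
    then show "integrable P (ell m)" "integral\<^sup>L P (ell m) = 0"
      using main[of m] by (auto simp: has_bochner_integral_iff v_def)
  qed
qed

end
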